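(* Let $n\ge2$ and suppose that $E\neq\emptyset$ is a closed set in $\mathbb{R}^n$. Let $1\le p,q<\infty$ and $\beta\ge0$ be such that $q(n-p+\beta)/p\neq n$ and that there is a constant $C>0$ such that the inequality $$\biggl(\int_{\mathbb{R}^n} |f(x)|^q \, \delta_E(x)^{(q/p)(n-p+\beta)-n}\,dx\biggr)^{1/q}\le C\biggl(\int_{\mathbb{R}^n} |\nabla f(x)|^p\,\delta_E(x)^\beta\,dx\biggr)^{1/p}$$ holds for every $f\in C^\infty_0(\mathbb{R}^n)$. Then $$\overline{\dim}_A(E)<\frac{q}{p}(n-p+\beta).$$
   Context: $\delta_E(x)=\operatorname{dist}(x,E)$; negative powers of $\delta_E$ are understood to equal $+\infty$ on $E$, with $0\cdot\infty=0$, and $\delta_E^0\equiv1$. $B(x,R)$ is the open ball, $d(E)$ is the diameter of $E$, and $C_0^\infty(\mathbb{R}^n)$ denotes smooth functions with compact support in $\mathbb{R}^n$. For bounded $A\subset\mathbb{R}^n$ and $r>0$, $N(A,r)$ is the minimal number of open balls of radius $r$ centered at points of $A$ needed to cover $A$. The (upper) Assouad dimension is $\overline{\dim}_A(E)=\inf\{\lambda\ge 0:\ \exists\, C_\lambda>0 \text{ such that } N(E\cap B(x,R),r)\le C_\lambda (r/R)^{-\lambda}\text{ for all } x\in E,\ 0<r<R<d(E)\}$. *)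

theory Defs
  imports "HOL-Analysis.Analysis"
begin

definition partial_deriv :: "'n \<Rightarrow> (real ^ 'n \<Rightarrow> real) \<Rightarrow> real ^ 'n \<Rightarrow> real" where
  "partial_deriv i f x = frechet_derivative f (at x) (axis i 1)"

text \<open>Since \<^const>\<open>frechet_derivative\<close> is an arbitrary function at points of non-differentiability,
  differentiability is required separately at every stage.\<close>

fun C_k :: "nat \<Rightarrow> (real ^ 'n::finite \<Rightarrow> real) \<Rightarrow> bool" where
  "C_k 0 f \<longleftrightarrow> continuous_on UNIV f"
| "C_k (Suc k) f \<longleftrightarrow> (\<forall>x. f differentiable (at x)) \<and> (\<forall>i. C_k k (partial_deriv i f))"

definition C0_infinity :: "(real ^ 'n::finite \<Rightarrow> real) set" where
  "C0_infinity = {f. (\<forall>k. C_k k f) \<and> compact (closure {x. f x \<noteq> 0})}"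

definition gradient :: "(real ^ 'n::finite \<Rightarrow> real) \<Rightarrow> real ^ 'n \<Rightarrow> real ^ 'n" where
  "gradient f x = (\<chi> i. partial_deriv i f x)"

text \<open>Real powers on \<open>[0, \<infinity>]\<close>, with \<open>a\<^sup>0 = 1\<close> for all \<open>a\<close>, and with \<open>0\<^sup>s = \<infinity>\<close> and \<open>\<infinity>\<^sup>s = 0\<close>
  for \<open>s < 0\<close>; note that \<^const>\<open>powr\<close> yields \<open>0\<close> at base \<open>0\<close> for every exponent.\<close>

definition ennpowr :: "ennreal \<Rightarrow> real \<Rightarrow> ennreal" where
  "ennpowr a s =
    (if s = 0 then 1
     else if a = 0 then (if s < 0 then \<infinity> else 0)
     else if a = \<infinity> then (if s < 0 then 0 else \<infinity>)
     else ennreal (enn2real a powr s))"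

definition dist_powr :: "'a::metric_space set \<Rightarrow> real \<Rightarrow> 'a \<Rightarrow> ennreal" where
  "dist_powr E s x = ennpowr (ennreal (infdist x E)) s"

text \<open>Unlike \<^const>\<open>diameter\<close>, this is \<open>\<infinity>\<close> for unbounded sets.\<close>

definition ediameter :: "'a::metric_space set \<Rightarrow> ereal" where
  "ediameter E = (SUP (x, y) \<in> E \<times> E. ereal (dist x y))"

text \<open>For a bounded subset of a Euclidean space and \<open>r > 0\<close> a finite cover exists, so the least
  element is a genuine one.\<close>

definition covering_number :: "'a::metric_space set \<Rightarrow> real \<Rightarrow> nat" where
  "covering_number A r =
    (LEAST k. \<exists>S. finite S \<and> card S = k \<and> S \<subseteq> A \<and> A \<subseteq> (\<Union>y\<in>S. ball y r))"

definition upper_assouad_dim :: "'a::metric_space set \<Rightarrow> ereal" where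
  "upper_assouad_dim E =
    Inf {ereal l | l. l \<ge> 0 \<and>
      (\<exists>C>0. \<forall>x\<in>E. \<forall>r R. 0 < r \<and> r < R \<and> ereal R < ediameter E \<longrightarrow>
        real (covering_number (E \<inter> ball x R) r) \<le> C * (r / R) powr (- l))}"

end

theory Submission
  imports Defs
begin

text \<open>
  Write \<open>n\<close> for the dimension of the space, \<open>d\<close> for the distance to \<open>E\<close> and
  \<open>s = (q / p) (n - p + \<beta>)\<close>. If \<open>s > n\<close>, it suffices that every set has dimension at
  most \<open>n\<close>, by a volume count (\<open>upper_assouad_dim_le_DIM\<close>). The content is the case \<open>s < n\<close>.

  There the inequality is tested with a smooth bump that is bounded below on \<open>B(x,R)\<close>, for
  \<open>x \<in> E\<close>, lives on \<open>B(x,2R)\<close> and has gradient of size \<open>1/R\<close>. On \<open>B(x,2R)\<close> the weight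
  \<open>d\<^sup>\<beta>\<close> is at most \<open>(2R)\<^sup>\<beta>\<close> because \<open>\<beta> \<ge> 0\<close>, and what remains is Aikawa's condition: the
  integral of \<open>d\<close> to the power \<open>s - n\<close> over \<open>B(x,R)\<close> is at most \<open>C R\<^sup>s\<close>
  (\<open>aikawa_if_hardy_sobolev\<close>).

  Aikawa's condition bounds the dimension by \<open>s\<close> at once. The strict inequality is a
  self-improvement, usually drawn from Gehring's lemma; here it comes from counting. By the
  layer-cake formula the condition bounds the sum over \<open>k = 1, ..., K\<close> of
  \<open>2\<^bsup>k (n - s)\<^esup>\<close> times the volume of the \<open>2\<^bsup>-k\<^esup> R\<close>-neighbourhood of \<open>E\<close> in \<open>B(x,2R)\<close>
  by a constant times \<open>R\<^sup>n\<close>, independently of \<open>K\<close>. So for a fixed large \<open>K\<close> one of the terms is as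
  small as desired, and at that scale \<open>E \<inter> B(x,R)\<close> is covered by at most half of \<open>2\<^bsup>k s\<^esup>\<close> balls of
  radius \<open>2\<^bsup>-k\<^esup> R\<close> (\<open>cover_with_gain\<close>). As \<open>k \<le> K\<close>, the factor one half is absorbed by replacing
  \<open>s\<close> with \<open>t = s - 1 / K\<close>. Covering each small ball in the same way, and so on down to
  a prescribed radius \<open>r\<close>, gives a covering with a multiple of \<open>(R / r)\<^sup>t\<close> balls
  (\<open>iterated_cover\<close>), hence dimension at most \<open>t < s\<close>.
\<close>

section \<open>Extended powers and distance weights\<close>

lemma ennpowr_le_D:
  assumes "ennpowr a e \<le> ennreal c" "0 < e"
  shows "a \<le> ennreal (c powr (1 / e))"
proof (cases "a = 0 \<or> a = \<infinity>")
  case True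
  then show ?thesis using assms by (auto simp: ennpowr_def top_unique)
next
  case False
  then obtain u where u: "a = ennreal u" "u > 0"
    by (cases a) (auto simp: less_le)
  then have "u powr e \<le> c"
    using assms False by (auto simp: ennpowr_def ennreal_le_iff2)
  then have "(u powr e) powr (1 / e) \<le> c powr (1 / e)"
    using assms by (intro powr_mono2) auto
  then show ?thesis using u assms by (simp add: powr_powr ennreal_leI)
qed

lemma ennpowr_le_I:
  assumes "a \<le> ennreal c" "0 < e" "0 \<le> c"
  shows "ennpowr a e \<le> ennreal (c powr e)"
proof -
  obtain u where u: "a = ennreal u" "u \<ge> 0"
    using assms by (cases a) (auto simp: top_unique)
  then have "u \<le> c" using assms by simp
  then have "u powr e \<le> c powr e" using u assms by (intro powr_mono2) auto
  then show ?thesis using u assms by (auto simp: ennpowr_def ennreal_leI)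
qed

lemma dist_powr_measurable [measurable]:
  fixes E :: "'a::euclidean_space set"
  shows "dist_powr E s \<in> borel_measurable borel"
proof -
  have [measurable]: "(\<lambda>x. infdist x E) \<in> borel_measurable borel"
    by (intro borel_measurable_continuous_onI continuous_intros)
  show ?thesis unfolding dist_powr_def[abs_def] ennpowr_def by measurable
qed

lemma dist_powr_pos: "infdist x E > 0 \<Longrightarrow> dist_powr E s x = ennreal (infdist x E powr s)"
  by (simp add: dist_powr_def ennpowr_def)

lemma dist_powr_zero: "infdist x E = 0 \<Longrightarrow> s < 0 \<Longrightarrow> dist_powr E s x = \<infinity>"
  by (simp add: dist_powr_def ennpowr_def)

lemma dist_powr_le:
  assumes "infdist x E \<le> D" "0 \<le> s" "0 < D"
  shows "dist_powr E s x \<le> ennreal (D powr s)"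
proof (cases "s = 0")
  case True then show ?thesis using assms by (simp add: dist_powr_def ennpowr_def)
next
  case False
  then show ?thesis unfolding dist_powr_def
    using assms by (intro ennpowr_le_I) (auto simp: ennreal_leI)
qed

section \<open>Separated nets and covering numbers\<close>

definition separated :: "real \<Rightarrow> 'a::metric_space set \<Rightarrow> bool" where
  "separated r S \<longleftrightarrow> (\<forall>x\<in>S. \<forall>y\<in>S. x \<noteq> y \<longrightarrow> r \<le> dist x y)"

text \<open>
  Balls of half the separation are disjoint, so their total volume fits into \<open>V\<close>.
\<close>

lemma separated_volume_bound:
  fixes S :: "'a::euclidean_space set"
  assumes "finite S" "separated r S" "0 < r" "V \<in> lmeasurable" "\<And>y. y \<in> S \<Longrightarrow> ball y (r / 2) \<subseteq> V"
  shows "real (card S) * (unit_ball_vol (real DIM('a)) * (r / 2) ^ DIM('a)) \<le> measure lebesgue V"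
proof -
  have "measure lebesgue (\<Union>y\<in>S. ball y (r / 2)) = (\<Sum>y\<in>S. measure lebesgue (ball y (r / 2)))"
  proof (rule measure_UNION')
    show "pairwise (\<lambda>i j. disjnt (ball i (r / 2)) (ball j (r / 2))) S"
    proof (rule pairwiseI)
      fix x y assume "x \<in> S" "y \<in> S" "x \<noteq> y"
      then have "r \<le> dist x y" using assms by (auto simp: separated_def)
      then show "disjnt (ball x (r / 2)) (ball y (r / 2))"
        unfolding disjnt_def by (intro disjoint_ballI) simp
    qed
  qed (use assms in auto)
  also have "\<dots> = real (card S) * (unit_ball_vol (real DIM('a)) * (r / 2) ^ DIM('a))"
    using assms by (simp add: content_ball)
  finally have "real (card S) * (unit_ball_vol (real DIM('a)) * (r / 2) ^ DIM('a))
      = measure lebesgue (\<Union>y\<in>S. ball y (r / 2))" ..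
  also have "\<dots> \<le> measure lebesgue V"
    by (intro measure_mono_fmeasurable) (use assms in auto)
  finally show ?thesis .
qed

text \<open>
  The volume bound caps the cardinality of \<open>r\<close>-separated subsets of \<open>A\<close>, so one of maximal
  cardinality exists; a point of \<open>A\<close> missed by its \<open>r\<close>-balls could be added to it.
\<close>

lemma separated_net_exists:
  fixes A :: "'a::euclidean_space set"
  assumes "0 < r" "V \<in> lmeasurable" "\<And>y. y \<in> A \<Longrightarrow> ball y (r / 2) \<subseteq> V"
  obtains S where "finite S" "S \<subseteq> A" "A \<subseteq> (\<Union>y\<in>S. ball y r)"
    "real (card S) * (unit_ball_vol (real DIM('a)) * (r / 2) ^ DIM('a)) \<le> measure lebesgue V"
proof -
  define v where "v = unit_ball_vol (real DIM('a)) * (r / 2) ^ DIM('a)"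
  have "v > 0" using assms by (simp add: v_def)
  define P where "P S \<longleftrightarrow> finite S \<and> S \<subseteq> A \<and> separated r S" for S
  have vol: "real (card S) * v \<le> measure lebesgue V" if "P S" for S
    unfolding v_def using that assms by (intro separated_volume_bound) (auto simp: P_def)
  have bound: "card S < nat \<lfloor>measure lebesgue V / v\<rfloor> + 1" if "P S" for S
  proof -
    have "real (card S) \<le> measure lebesgue V / v"
      using vol[OF that] \<open>v > 0\<close> by (simp add: le_divide_eq)
    then show ?thesis by linarith
  qed
  have "P {}" by (simp add: P_def separated_def)
  then obtain S where S: "P S" and max: "\<And>T. P T \<Longrightarrow> card T \<le> card S"
    using Lattices_Big.ex_has_greatest_nat[of P "{}" card] bound by metis
  have "A \<subseteq> (\<Union>y\<in>S. ball y r)"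
  proof (rule subsetI, rule ccontr)
    fix a assume "a \<in> A"
    assume a: "a \<notin> (\<Union>y\<in>S. ball y r)"
    then have "P (insert a S)"
      using S \<open>a \<in> A\<close> by (auto simp: P_def separated_def not_less dist_commute)
    moreover have "a \<notin> S" using a assms by auto
    ultimately show False using max[of "insert a S"] S by (simp add: P_def)
  qed
  then show ?thesis using S vol[OF S] that unfolding P_def v_def by blast
qed

lemma covering_number_le_card:
  assumes "finite S" "S \<subseteq> A" "A \<subseteq> (\<Union>y\<in>S. ball y r)"
  shows "covering_number A r \<le> card S"
  unfolding covering_number_def by (rule Least_le) (use assms in blast)

text \<open>
  The balls that define the covering number are centred in the covered set. Moving an arbitrary
  centre to a point of \<open>A\<close> in its ball costs a factor 2 in the radius.
\<close>

lemma covering_number_double_le_card: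
  assumes "finite S" "A \<subseteq> (\<Union>y\<in>S. ball y r)"
  shows "covering_number A (2 * r) \<le> card S"
proof -
  define S' where "S' = {y \<in> S. ball y r \<inter> A \<noteq> {}}"
  have "\<forall>y\<in>S'. \<exists>z. z \<in> ball y r \<inter> A" by (auto simp: S'_def)
  then obtain f where f: "\<And>y. y \<in> S' \<Longrightarrow> f y \<in> ball y r \<inter> A" by metis
  have "A \<subseteq> (\<Union>y\<in>f ` S'. ball y (2 * r))"
  proof
    fix a assume "a \<in> A"
    then obtain y where "y \<in> S" "a \<in> ball y r" using assms by blast
    then have y: "y \<in> S'" "dist y a < r" using \<open>a \<in> A\<close> by (auto simp: S'_def)
    then have "dist (f y) a < 2 * r"
      using f[OF y(1)] dist_triangle_half_r[of y "f y" "2 * r" a] by simp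
    then show "a \<in> (\<Union>y\<in>f ` S'. ball y (2 * r))" using y by auto
  qed
  then have "covering_number A (2 * r) \<le> card (f ` S')"
    using f assms by (intro covering_number_le_card) (auto simp: S'_def)
  also have "\<dots> \<le> card S'" using assms by (intro card_image_le) (simp add: S'_def)
  also have "\<dots> \<le> card S" using assms by (intro card_mono) (auto simp: S'_def)
  finally show ?thesis .
qed

lemma upper_assouad_dim_le:
  assumes "0 \<le> t" "0 < C"
    and "\<And>x r R. x \<in> E \<Longrightarrow> 0 < r \<Longrightarrow> r < R \<Longrightarrow>
      real (covering_number (E \<inter> ball x R) r) \<le> C * (R / r) powr t"
  shows "upper_assouad_dim E \<le> ereal t"
proof -
  have "(r / R) powr (- t) = (R / r) powr t" if "0 < r" "r < R" for r R :: real
    using that by (simp add: powr_minus powr_divide)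
  then show ?thesis
    unfolding upper_assouad_dim_def using assms by (intro Inf_lower) auto
qed

lemma upper_assouad_dim_le_DIM:
  "upper_assouad_dim (E :: 'a::euclidean_space set) \<le> ereal (real DIM('a))"
proof (rule upper_assouad_dim_le)
  fix x :: 'a and r R :: real assume r: "0 < r" "r < R"
  obtain S where S: "finite S" "S \<subseteq> E \<inter> ball x R" "E \<inter> ball x R \<subseteq> (\<Union>y\<in>S. ball y r)"
    and vol: "real (card S) * (unit_ball_vol (real DIM('a)) * (r / 2) ^ DIM('a))
      \<le> measure lebesgue (ball x (2 * R))"
  proof (rule separated_net_exists)
    fix y assume "y \<in> E \<inter> ball x R"
    show "ball y (r / 2) \<subseteq> ball x (2 * R)"
    proof
      fix z assume "z \<in> ball y (r / 2)"
      then show "z \<in> ball x (2 * R)"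
        using r \<open>y \<in> E \<inter> ball x R\<close> dist_triangle[of x z y] by simp
    qed
  qed (use r in auto)
  have "real (card S) * (r / 2) ^ DIM('a) \<le> (2 * R) ^ DIM('a)"
    using vol r by (simp add: content_ball mult.left_commute)
  then have "real (card S) \<le> ((2 * R) / (r / 2)) ^ DIM('a)"
    using r by (simp only: power_divide) (simp add: field_simps)
  also have "\<dots> = 4 ^ DIM('a) * (R / r) powr real DIM('a)"
    using r by (simp add: powr_realpow flip: power_mult_distrib)
  finally show "real (covering_number (E \<inter> ball x R) r) \<le> 4 ^ DIM('a) * (R / r) powr real DIM('a)"
    using covering_number_le_card[OF S] by linarith
qed auto

section \<open>Self-improvement of the Aikawa condition\<close>

lemma sum_powers_le:
  fixes \<rho> :: real assumes "1 < \<rho>"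
  shows "(\<Sum>k=1..m. \<rho> ^ k) \<le> \<rho> / (\<rho> - 1) * \<rho> ^ m"
proof -
  have "(\<rho> - 1) * (\<Sum>k=1..m. \<rho> ^ k) \<le> \<rho> * \<rho> ^ m"
    using assms by (induction m) (auto simp: algebra_simps)
  then show ?thesis using assms by (simp add: le_divide_eq mult.commute)
qed

text \<open>
  The pointwise form of the layer-cake formula. The sum is geometric and stops at the last \<open>k\<close>
  with \<open>2\<^sup>k < R / d\<close>, so its last term, at most \<open>(R / d)\<^sup>a\<close>, dominates it.
\<close>

lemma sum_dyadic_levels_le:
  fixes a d R :: real
  assumes "0 < a" "0 < d" "0 < R"
  defines "\<rho> \<equiv> 2 powr a"
  shows "(\<Sum>k=1..K. \<rho> ^ k * of_bool (d < R / 2 ^ k)) \<le> \<rho> / (\<rho> - 1) * (R / d) powr a"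
proof -
  have \<rho>: "1 < \<rho>" using assms by simp
  show ?thesis
  proof (induction K)
    case 0 then show ?case using \<rho> by simp
  next
    case (Suc K)
    show ?case
    proof (cases "d < R / 2 ^ Suc K")
      case True
      have "\<rho> ^ Suc K = (2 ^ Suc K) powr a"
        unfolding \<rho>_def
        by (simp add: powr_powr mult.commute del: power_Suc of_nat_Suc flip: powr_realpow)
      also have "\<dots> \<le> (R / d) powr a"
        using True assms by (intro powr_mono2) (auto simp: field_simps)
      finally have le: "\<rho> ^ Suc K \<le> (R / d) powr a" .
      have "(\<Sum>k=1..Suc K. \<rho> ^ k * of_bool (d < R / 2 ^ k)) \<le> (\<Sum>k=1..Suc K. \<rho> ^ k)"
        using \<rho> by (intro sum_mono) auto
      also have "\<dots> \<le> \<rho> / (\<rho> - 1) * \<rho> ^ Suc K" by (rule sum_powers_le[OF \<rho>])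
      also have "\<dots> \<le> \<rho> / (\<rho> - 1) * (R / d) powr a"
        using le \<rho> by (intro mult_left_mono) auto
      finally show ?thesis .
    next
      case False
      then show ?thesis using Suc by simp
    qed
  qed
qed

lemma open_near_in_ball: "open {y \<in> ball x R. infdist y E < r}"
proof -
  have "{y \<in> ball x R. infdist y E < r} = ball x R \<inter> {y. infdist y E < r}" by auto
  also have "open \<dots>"
    by (intro open_Int open_ball open_Collect_less continuous_intros)
  finally show ?thesis .
qed

lemma near_in_ball_lmeasurable:
  fixes E :: "'a::euclidean_space set"
  shows "{y \<in> ball x R. infdist y E < r} \<in> lmeasurable"
proof (rule lmeasurable_open[OF _ open_near_in_ball])
  show "bounded {y \<in> ball x R. infdist y E < r}"
    by (rule bounded_subset[OF bounded_ball]) auto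
qed

text \<open>
  The pigeonhole step. If all \<open>K\<close> neighbourhoods were large, then integrating
  \<open>sum_dyadic_levels_le\<close> over \<open>B(x,2R)\<close> would contradict the bound on the integral of the
  weight, as soon as \<open>K\<close> exceeds a threshold that depends neither on \<open>x\<close> nor on \<open>R\<close>.
\<close>

lemma small_dyadic_neighbourhood:
  fixes E :: "'a::euclidean_space set" and s C R \<eta> :: real
  assumes "s < real DIM('a)" "0 < R" "0 \<le> C"
    and aikawa: "(\<integral>\<^sup>+y\<in>ball x (2 * R). dist_powr E (s - real DIM('a)) y \<partial>lborel) \<le> ennreal (C * (2 * R) powr s)"
  defines "\<rho> \<equiv> 2 powr (real DIM('a) - s)"
  assumes K: "\<rho> / (\<rho> - 1) * C * 2 powr s < real K * \<eta>"
  shows "\<exists>k\<in>{1..K}. measure lebesgue {y \<in> ball x (2 * R). infdist y E < R / 2 ^ k}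
    \<le> \<eta> * R ^ DIM('a) / \<rho> ^ k"
proof (rule ccontr)
  assume neg: "\<not> ?thesis"
  define a where "a = real DIM('a) - s"
  define c where "c = \<rho> / (\<rho> - 1)"
  define A where "A k = {y \<in> ball x (2 * R). infdist y E < R / 2 ^ k}" for k
  have a: "0 < a" and \<rho>: "1 < \<rho>" "\<rho> = 2 powr a" using assms by (auto simp: a_def)
  have "0 < c" using \<rho> by (simp add: c_def)
  have A_borel [measurable]: "A k \<in> sets borel" and "A k \<in> lmeasurable" for k
    unfolding A_def using open_near_in_ball[of x "2 * R" E] near_in_ball_lmeasurable by auto
  then have "emeasure lebesgue (A k) = ennreal (measure lebesgue (A k))" for k
    by (simp add: emeasure_eq_measure2)
  then have em: "emeasure lborel (A k) = ennreal (measure lebesgue (A k))" for k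
    by (simp add: emeasure_completion)
  have large: "\<eta> * R ^ DIM('a) \<le> \<rho> ^ k * measure lebesgue (A k)" if "k \<in> {1..K}" for k
    using neg that \<rho> by (auto simp: A_def not_le divide_less_eq mult.commute intro: less_imp_le)
  have pointwise: "(\<Sum>k=1..K. ennreal (\<rho> ^ k) * indicator (A k) y)
      \<le> ennreal (c * R powr a) * (dist_powr E (- a) y * indicator (ball x (2 * R)) y)" for y
  proof (cases "y \<in> ball x (2 * R)")
    case False
    then show ?thesis by (simp add: A_def)
  next
    case y: True
    show ?thesis
    proof (cases "infdist y E = 0")
      case True
      then show ?thesis using y a \<open>0 < c\<close> \<open>0 < R\<close> by (simp add: dist_powr_zero ennreal_mult_top)
    next
      case False
      then have d: "0 < infdist y E" using infdist_nonneg[of y E] by simp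
      have "(\<Sum>k=1..K. ennreal (\<rho> ^ k) * indicator (A k) y)
          = ennreal (\<Sum>k=1..K. \<rho> ^ k * of_bool (infdist y E < R / 2 ^ k))"
        using y \<rho> by (subst sum_ennreal[symmetric]) (auto simp: A_def indicator_def intro!: sum.cong)
      also have "\<dots> \<le> ennreal (c * (R / infdist y E) powr a)"
        unfolding c_def \<rho>(2) using a d \<open>0 < R\<close> by (intro ennreal_leI sum_dyadic_levels_le)
      also have "\<dots> = ennreal (c * R powr a) * dist_powr E (- a) y"
        using d \<open>0 < c\<close> \<open>0 < R\<close>
        by (simp add: dist_powr_pos powr_divide powr_minus_divide flip: ennreal_mult)
      finally show ?thesis using y by simp
    qed
  qed
  have "ennreal (real K * (\<eta> * R ^ DIM('a))) = ennreal (\<Sum>k=1..K. \<eta> * R ^ DIM('a))" by simp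
  also have "\<dots> \<le> ennreal (\<Sum>k=1..K. \<rho> ^ k * measure lebesgue (A k))"
    using large by (intro ennreal_leI sum_mono)
  also have "\<dots> = (\<Sum>k=1..K. ennreal (\<rho> ^ k) * emeasure lborel (A k))"
    using \<rho> unfolding em by (simp flip: ennreal_mult sum_ennreal)
  also have "\<dots> = (\<integral>\<^sup>+y. (\<Sum>k=1..K. ennreal (\<rho> ^ k) * indicator (A k) y) \<partial>lborel)"
    by (subst nn_integral_sum) (simp_all add: nn_integral_cmult_indicator)
  also have "\<dots> \<le> (\<integral>\<^sup>+y. ennreal (c * R powr a) * (dist_powr E (- a) y * indicator (ball x (2 * R)) y) \<partial>lborel)"
    by (intro nn_integral_mono pointwise)
  also have "\<dots> = ennreal (c * R powr a) * (\<integral>\<^sup>+y\<in>ball x (2 * R). dist_powr E (- a) y \<partial>lborel)"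
    by (intro nn_integral_cmult borel_measurable_times_ennreal borel_measurable_indicator)
      (simp_all add: dist_powr_measurable)
  also have "\<dots> \<le> ennreal (c * R powr a) * ennreal (C * (2 * R) powr s)"
    using aikawa by (intro mult_left_mono) (auto simp: a_def)
  also have "\<dots> = ennreal (c * R powr a * (C * (2 * R) powr s))"
    using \<open>0 < c\<close> assms by (simp add: ennreal_mult)
  also have "c * R powr a * (C * (2 * R) powr s) = c * C * 2 powr s * R ^ DIM('a)"
  proof -
    have "R powr a * R powr s = R ^ DIM('a)"
      using \<open>0 < R\<close> by (simp add: a_def powr_realpow flip: powr_add)
    then show ?thesis using \<open>0 < R\<close> by (simp add: powr_mult mult.assoc mult.left_commute)
  qed
  finally have "real K * (\<eta> * R ^ DIM('a)) \<le> c * C * 2 powr s * R ^ DIM('a)"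
    using \<open>0 < c\<close> assms by (subst (asm) ennreal_le_iff) auto
  then have "real K * \<eta> \<le> c * C * 2 powr s" using \<open>0 < R\<close> by (simp add: mult.assoc[symmetric])
  then show False using K by (simp add: c_def)
qed

text \<open>
  At the scale found by \<open>small_dyadic_neighbourhood\<close>, a maximal separated net of \<open>E \<inter> B(x,R)\<close> has
  few points, since the disjoint balls around them lie in the small neighbourhood of \<open>E\<close>. The bound
  \<open>2\<^bsup>k s\<^esup>\<close> alone would only give dimension at most \<open>s\<close>; the factor one half makes the inequality
  strict. The scale \<open>k\<close> may vary with the ball, but \<open>K\<close> does not.
\<close>

lemma cover_with_gain:
  fixes E :: "'a::euclidean_space set" and s C :: real
  assumes "s < real DIM('a)" "0 \<le> C"
    and aikawa: "\<And>x R. x \<in> E \<Longrightarrow> 0 < R \<Longrightarrow>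
      (\<integral>\<^sup>+y\<in>ball x R. dist_powr E (s - real DIM('a)) y \<partial>lborel) \<le> ennreal (C * R powr s)"
  shows "\<exists>K. \<forall>x\<in>E. \<forall>R>0. \<exists>k\<in>{1..K}. \<exists>S. finite S \<and> S \<subseteq> E \<and>
      E \<inter> ball x R \<subseteq> (\<Union>y\<in>S. ball y (R / 2 ^ k)) \<and> real (card S) \<le> 2 powr (real k * s) / 2"
proof -
  define \<rho> where "\<rho> = 2 powr (real DIM('a) - s)"
  define \<omega> where "\<omega> = unit_ball_vol (real DIM('a))"
  \<comment> \<open>The quotient \<open>\<omega> / 2 ^ n\<close> is the volume of a ball of radius 1/2; the last 2 is the gain.\<close>
  define \<eta> where "\<eta> = \<omega> / 2 ^ DIM('a) / 2"
  have "0 < \<omega>" "0 < \<eta>" by (auto simp: \<omega>_def \<eta>_def)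
  obtain K :: nat where K: "\<rho> / (\<rho> - 1) * C * 2 powr s < real K * \<eta>"
    using reals_Archimedean3[OF \<open>0 < \<eta>\<close>] by blast
  show ?thesis
  proof (intro exI[of _ K] ballI allI impI)
    fix x :: 'a and R :: real assume x: "x \<in> E" "0 < R"
    obtain k where k: "k \<in> {1..K}" and small:
      "measure lebesgue {y \<in> ball x (2 * R). infdist y E < R / 2 ^ k} \<le> \<eta> * R ^ DIM('a) / \<rho> ^ k"
      using small_dyadic_neighbourhood[OF assms(1) x(2) assms(2) aikawa[OF x(1)] K[unfolded \<rho>_def]] x(2)
      unfolding \<rho>_def by auto
    let ?r = "R / 2 ^ k" and ?V = "{y \<in> ball x (2 * R). infdist y E < R / 2 ^ k}"
    have "0 < ?r" "?r \<le> R" using x by (auto simp: divide_le_eq)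
    obtain S where S: "finite S" "S \<subseteq> E \<inter> ball x R" "E \<inter> ball x R \<subseteq> (\<Union>y\<in>S. ball y ?r)"
      and vol: "real (card S) * (\<omega> * (?r / 2) ^ DIM('a)) \<le> measure lebesgue ?V"
      unfolding \<omega>_def
    proof (rule separated_net_exists[OF \<open>0 < ?r\<close> near_in_ball_lmeasurable])
      fix y assume y: "y \<in> E \<inter> ball x R"
      show "ball y (?r / 2) \<subseteq> ?V"
      proof
        fix z assume z: "z \<in> ball y (?r / 2)"
        have "infdist z E \<le> dist z y" using y by (intro infdist_le) simp
        then show "z \<in> ?V"
          using y z \<open>0 < ?r\<close> \<open>?r \<le> R\<close> dist_triangle[of x z y] by (simp add: dist_commute)
      qed
    qed
    have "real (card S) * (\<omega> * (?r / 2) ^ DIM('a)) \<le> \<eta> * R ^ DIM('a) / \<rho> ^ k"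
      using vol small by linarith
    then have "real (card S) \<le> (\<eta> * R ^ DIM('a) / \<rho> ^ k) / (\<omega> * (?r / 2) ^ DIM('a))"
      using \<open>0 < ?r\<close> \<open>0 < \<omega>\<close> by (subst pos_le_divide_eq) auto
    also have "\<dots> = (2 ^ k) ^ DIM('a) / \<rho> ^ k / 2"
      using x \<open>0 < \<omega>\<close> by (simp add: \<eta>_def power_divide)
    also have "(2 ^ k) ^ DIM('a) / \<rho> ^ k = 2 powr (real k * s)"
    proof -
      have "\<rho> ^ k = 2 powr (real k * (real DIM('a) - s))"
        by (simp add: \<rho>_def powr_powr mult.commute flip: powr_realpow)
      moreover have "(2 ^ k) ^ DIM('a) = (2::real) powr (real k * real DIM('a))"
        by (simp add: powr_realpow flip: power_mult of_nat_mult)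
      ultimately show ?thesis by (simp add: algebra_simps flip: powr_diff)
    qed
    finally show "\<exists>k\<in>{1..K}. \<exists>S. finite S \<and> S \<subseteq> E \<and>
      E \<inter> ball x R \<subseteq> (\<Union>y\<in>S. ball y (R / 2 ^ k)) \<and> real (card S) \<le> 2 powr (real k * s) / 2"
      using S k by (intro bexI[of _ k] exI[of _ S] conjI) auto
  qed
qed

text \<open>
  Induction on the number of halvings that take \<open>R\<close> below \<open>r\<close>. The covering is refined until the
  radius drops below \<open>r\<close>; as the steps have different lengths \<open>k \<le> K\<close>, the final radius may
  undershoot \<open>r\<close> by up to \<open>2\<^sup>K\<close>, which is the constant \<open>2\<^bsup>K t\<^esup>\<close>. With exponent \<open>t\<close> the counts
  multiply exactly and no constant accumulates.
\<close>

lemma iterated_cover: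
  fixes E :: "'a::metric_space set"
  assumes "0 \<le> t"
    and step: "\<forall>x\<in>E. \<forall>R>0. \<exists>k\<in>{1..K}. \<exists>S. finite S \<and> S \<subseteq> E \<and>
      E \<inter> ball x R \<subseteq> (\<Union>y\<in>S. ball y (R / 2 ^ k)) \<and> real (card S) \<le> 2 powr (real k * t)"
    and "x \<in> E" "0 < r" "0 < R"
  shows "\<exists>S. finite S \<and> S \<subseteq> E \<and> E \<inter> ball x R \<subseteq> (\<Union>y\<in>S. ball y r) \<and>
      real (card S) \<le> 2 powr (real K * t) * max 1 (R / r) powr t"
proof -
  obtain m :: nat where "R / r < 2 ^ m" using real_arch_pow[of 2 "R / r"] by auto
  then have "R \<le> 2 ^ m * r" using \<open>0 < r\<close> by (simp add: divide_less_eq)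
  then show ?thesis using \<open>x \<in> E\<close> \<open>0 < R\<close>
  proof (induction m arbitrary: x R)
    case 0
    have "1 \<le> (2::real) powr (real K * t)" using assms by (intro ge_one_powr_ge_zero) auto
    then show ?case using 0 assms by (intro exI[of _ "{x}"]) (auto simp: max_def)
  next
    case (Suc m)
    from step[rule_format, OF Suc.prems(2,3)] obtain k S where k: "1 \<le> k" "k \<le> K" and S: "finite S" "S \<subseteq> E"
      "E \<inter> ball x R \<subseteq> (\<Union>y\<in>S. ball y (R / 2 ^ k))" "real (card S) \<le> 2 powr (real k * t)" by auto
    show ?case
    proof (cases "R / 2 ^ k \<le> r")
      case True
      have "real (card S) \<le> 2 powr (real K * t) * 1"
        using S(4) k assms by (auto intro!: order.trans[OF S(4)] powr_mono mult_right_mono)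
      also have "\<dots> \<le> 2 powr (real K * t) * max 1 (R / r) powr t"
        using assms by (intro mult_left_mono ge_one_powr_ge_zero) auto
      finally have "real (card S) \<le> 2 powr (real K * t) * max 1 (R / r) powr t" .
      moreover have "E \<inter> ball x R \<subseteq> (\<Union>y\<in>S. ball y r)"
        using S(3) subset_ball[OF True] by blast
      ultimately show ?thesis using S by blast
    next
      case False
      have "2 \<le> (2::real) ^ k" using power_increasing[of 1 k "2::real"] k by simp
      then have "R / 2 ^ k \<le> R / 2" using Suc.prems by (intro divide_left_mono) auto
      also have "R / 2 \<le> 2 ^ m * r" using Suc.prems by simp
      finally have "R / 2 ^ k \<le> 2 ^ m * r" .
      then have "\<forall>y\<in>S. \<exists>T. finite T \<and> T \<subseteq> E \<and> E \<inter> ball y (R / 2 ^ k) \<subseteq> (\<Union>z\<in>T. ball z r) \<and>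
          real (card T) \<le> 2 powr (real K * t) * max 1 ((R / 2 ^ k) / r) powr t"
        using Suc.prems S by (intro ballI Suc.IH) auto
      then obtain T where T: "\<And>y. y \<in> S \<Longrightarrow> finite (T y) \<and> T y \<subseteq> E \<and>
          E \<inter> ball y (R / 2 ^ k) \<subseteq> (\<Union>z\<in>T y. ball z r) \<and>
          real (card (T y)) \<le> 2 powr (real K * t) * max 1 ((R / 2 ^ k) / r) powr t" by metis
      let ?U = "\<Union>y\<in>S. T y"
      have r: "max 1 ((R / 2 ^ k) / r) = R / r / 2 ^ k" using False \<open>0 < r\<close> by (auto simp: field_simps)
      have "1 \<le> R / r"
      proof -
        have "R / 2 ^ k \<le> R" using Suc.prems by (simp add: divide_le_eq)
        then show ?thesis using False \<open>0 < r\<close> by simp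
      qed
      have "real (card ?U) \<le> (\<Sum>y\<in>S. real (card (T y)))"
        using card_UN_le[OF S(1), of T] by (metis of_nat_le_iff of_nat_sum)
      also have "\<dots> \<le> real (card S) * (2 powr (real K * t) * (R / r / 2 ^ k) powr t)"
        using T unfolding r by (intro sum_bounded_above) auto
      also have "\<dots> \<le> 2 powr (real k * t) * (2 powr (real K * t) * (R / r / 2 ^ k) powr t)"
        using S by (intro mult_right_mono) auto
      also have "\<dots> = 2 powr (real K * t) * (R / r) powr t"
      proof -
        have "(R / r / 2 ^ k) powr t = (R / r) powr t / 2 powr (real k * t)"
          using Suc.prems \<open>0 < r\<close> by (subst powr_divide) (auto simp: powr_powr simp flip: powr_realpow)
        then show ?thesis by simp
      qed
      finally have "real (card ?U) \<le> 2 powr (real K * t) * max 1 (R / r) powr t"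
        using \<open>1 \<le> R / r\<close> by (simp add: max_def)
      moreover have "E \<inter> ball x R \<subseteq> (\<Union>z\<in>?U. ball z r)"
      proof
        fix a assume a: "a \<in> E \<inter> ball x R"
        then obtain y where y: "y \<in> S" "a \<in> E \<inter> ball y (R / 2 ^ k)" using S(3) by blast
        then have "a \<in> (\<Union>z\<in>T y. ball z r)" using T[OF y(1)] by (meson subsetD)
        then show "a \<in> (\<Union>z\<in>?U. ball z r)" using y(1) by blast
      qed
      moreover have "finite ?U" using S(1) T by simp
      moreover have "?U \<subseteq> E" using T by (intro UN_least) simp
      ultimately show ?thesis by (intro exI[of _ ?U] conjI)
    qed
  qed
qed

text \<open>
  With \<open>t = s - 1 / K\<close>, the bound \<open>2\<^bsup>k s\<^esup> / 2 = 2\<^bsup>k s - 1\<^esup>\<close> is at most \<open>2\<^bsup>k t\<^esup>\<close> for every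
  \<open>k \<le> K\<close>. That \<open>t\<close> is nonnegative, as a dimension bound must be, also follows from the
  covering: it has at least one ball, and \<open>1 \<le> 2\<^bsup>k s\<^esup> / 2\<close> forces \<open>s \<ge> 1 / k \<ge> 1 / K\<close>.
\<close>

lemma upper_assouad_dim_less_if_aikawa:
  fixes E :: "'a::euclidean_space set" and s C :: real
  assumes "E \<noteq> {}" "s < real DIM('a)" "0 \<le> C"
    and aikawa: "\<And>x R. x \<in> E \<Longrightarrow> 0 < R \<Longrightarrow>
      (\<integral>\<^sup>+y\<in>ball x R. dist_powr E (s - real DIM('a)) y \<partial>lborel) \<le> ennreal (C * R powr s)"
  shows "upper_assouad_dim E < ereal s"
proof -
  obtain K where step: "\<forall>x\<in>E. \<forall>R>0. \<exists>k\<in>{1..K}. \<exists>S. finite S \<and> S \<subseteq> E \<and>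
      E \<inter> ball x R \<subseteq> (\<Union>y\<in>S. ball y (R / 2 ^ k)) \<and> real (card S) \<le> 2 powr (real k * s) / 2"
    using cover_with_gain[OF assms(2,3), of E] aikawa by blast
  define t where "t = s - 1 / real K"
  obtain x\<^sub>0 where x0: "x\<^sub>0 \<in> E" using assms by auto
  from step[rule_format, OF x0, of 1] obtain k S where k: "1 \<le> k" "k \<le> K" and S: "finite S"
    "E \<inter> ball x\<^sub>0 1 \<subseteq> (\<Union>y\<in>S. ball y (1 / 2 ^ k))" "real (card S) \<le> 2 powr (real k * s) / 2" by auto
  have "x\<^sub>0 \<in> E \<inter> ball x\<^sub>0 1" using x0 by simp
  then have "S \<noteq> {}" using S by blast
  then have "1 \<le> card S" using S by (simp add: Suc_le_eq card_gt_0_iff)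
  then have "2 powr 1 \<le> (2::real) powr (real k * s)" using S by simp
  then have "1 \<le> real k * s" by (subst (asm) powr_le_cancel_iff) auto
  then have "1 / real k \<le> s" using k by (simp add: divide_le_eq mult.commute)
  moreover have "1 / real K \<le> 1 / real k" using k by (intro divide_left_mono) auto
  ultimately have "0 \<le> t" by (simp add: t_def)
  have gain: "2 powr (real j * s) / 2 \<le> 2 powr (real j * t)" if "j \<in> {1..K}" for j
  proof -
    have "2 powr (real j * s) / 2 = 2 powr (real j * s - 1)" by (simp add: powr_diff)
    also have "\<dots> \<le> 2 powr (real j * t)"
      using that by (intro powr_mono) (auto simp: t_def right_diff_distrib divide_le_eq)
    finally show ?thesis .
  qed
  have step': "\<forall>x\<in>E. \<forall>R>0. \<exists>k\<in>{1..K}. \<exists>S. finite S \<and> S \<subseteq> E \<and>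
      E \<inter> ball x R \<subseteq> (\<Union>y\<in>S. ball y (R / 2 ^ k)) \<and> real (card S) \<le> 2 powr (real k * t)"
  proof (intro ballI allI impI)
    fix x :: 'a and R :: real assume "x \<in> E" "0 < R"
    from step[rule_format, OF this] obtain k S where k: "k \<in> {1..K}" and S: "finite S" "S \<subseteq> E"
      "E \<inter> ball x R \<subseteq> (\<Union>y\<in>S. ball y (R / 2 ^ k))" "real (card S) \<le> 2 powr (real k * s) / 2"
      by (elim bexE exE conjE)
    from S(4) gain[OF k] have "real (card S) \<le> 2 powr (real k * t)" by linarith
    with k S show "\<exists>k\<in>{1..K}. \<exists>S. finite S \<and> S \<subseteq> E \<and>
      E \<inter> ball x R \<subseteq> (\<Union>y\<in>S. ball y (R / 2 ^ k)) \<and> real (card S) \<le> 2 powr (real k * t)"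
      by (intro bexI[of _ k] exI[of _ S] conjI)
  qed
  have "upper_assouad_dim E \<le> ereal t"
  proof (rule upper_assouad_dim_le[OF \<open>0 \<le> t\<close>])
    fix x r R assume x: "x \<in> E" and r: "0 < r" "r < (R::real)"
    obtain S where S: "finite S" "E \<inter> ball x R \<subseteq> (\<Union>y\<in>S. ball y (r / 2))"
      "real (card S) \<le> 2 powr (real K * t) * max 1 (R / (r / 2)) powr t"
      using iterated_cover[OF \<open>0 \<le> t\<close> step' x, of "r / 2" R] r by auto
    have "max 1 (R / (r / 2)) powr t = (2 * (R / r)) powr t" using r by (simp add: max_def field_simps)
    also have "\<dots> = 2 powr t * (R / r) powr t" using r by (subst powr_mult) auto
    finally have "real (card S) \<le> 2 powr (real K * t) * 2 powr t * (R / r) powr t"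
      using S(3) by (simp only: mult.assoc)
    then show "real (covering_number (E \<inter> ball x R) r) \<le> 2 powr (real K * t) * 2 powr t * (R / r) powr t"
      using covering_number_double_le_card[OF S(1,2)] by simp
  qed simp
  also have "ereal t < ereal s" using k by (simp add: t_def)
  finally show ?thesis .
qed

section \<open>A smooth bump function\<close>

text \<open>
  The powers of \<open>t\<close> in the denominator make the family closed under differentiation up to linear
  combinations, which allows smoothness of compositions to be proved for all \<open>j\<close> at once.
\<close>

definition flat :: "nat \<Rightarrow> real \<Rightarrow> real" where
  "flat j t = (if t > 0 then exp (- (1 / t)) / t ^ j else 0)"

lemma flat_nonneg: "0 \<le> flat j t"
  by (simp add: flat_def)

lemma power_over_fact_le_exp:
  fixes z :: real assumes "0 \<le> z" shows "z ^ j / fact j \<le> exp z"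
proof -
  have "(\<Sum>n\<in>{j}. z ^ n /\<^sub>R fact n) \<le> (\<Sum>n. z ^ n /\<^sub>R fact n)"
    by (rule sum_le_suminf) (use assms summable_exp_generic[of z] in auto)
  then show ?thesis by (simp add: exp_def divide_inverse mult.commute)
qed

lemma flat_le_fact: "flat j t \<le> fact j"
proof (cases "t > 0")
  case True
  have "(1 / t) ^ j / fact j \<le> exp (1 / t)"
    using True by (intro power_over_fact_le_exp) simp
  then have "(1 / t) ^ j \<le> fact j * exp (1 / t)"
    by (simp add: divide_le_eq mult.commute)
  then have "(1 / t) ^ j * exp (- (1 / t)) \<le> fact j"
    using mult_right_mono[of _ _ "exp (- (1 / t))"] by (fastforce simp: mult.assoc simp flip: exp_add)
  then show ?thesis using True by (simp add: flat_def power_one_over)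
qed (simp add: flat_def)

text \<open>
  This quadratic bound yields differentiability at \<open>0\<close>.
\<close>

lemma flat_le_square: "\<bar>flat j t\<bar> \<le> fact (j + 2) * t\<^sup>2"
proof (cases "t > 0")
  case True
  then have "flat j t = flat (j + 2) t * t\<^sup>2"
    by (simp add: flat_def power_add field_simps power2_eq_square)
  then show ?thesis
    using flat_le_fact[of "j + 2" t] flat_nonneg[of j t] by (simp add: mult_right_mono)
qed (simp add: flat_def)

lemma DERIV_flat:
  "(flat j has_real_derivative (flat (j + 2) t - real j * flat (j + 1) t)) (at t)"
proof -
  consider "t > 0" | "t < 0" | "t = 0" by linarith
  then show ?thesis
  proof cases
    case 1
    have ev: "eventually (\<lambda>x. flat j x = exp (- (1 / x)) / x ^ j) (nhds t)"
      using eventually_nhds_in_open[of "{0<..}" t] 1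
      by (auto elim!: eventually_mono simp: flat_def)
    have d1: "((\<lambda>x. exp (- inverse x)) has_real_derivative exp (- inverse t) * (inverse t)\<^sup>2) (at t)"
      using 1 by (auto intro!: derivative_eq_intros simp: power2_eq_square)
    have d2: "((\<lambda>x. inverse x ^ j) has_real_derivative - (real j * inverse t ^ (j + 1))) (at t)"
      using DERIV_power[OF DERIV_inverse[of t UNIV], of j] 1
      by (cases j) (simp_all add: algebra_simps)
    have "exp (- inverse t) * (inverse t)\<^sup>2 * inverse t ^ j
        + - (real j * inverse t ^ (j + 1)) * exp (- inverse t)
        = flat (j + 2) t - real j * flat (j + 1) t"
      using 1 by (simp add: flat_def divide_inverse power_inverse power_add power2_eq_square algebra_simps)
    with DERIV_mult[OF d1 d2]
    have "((\<lambda>x. exp (- inverse x) * inverse x ^ j) has_real_derivative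
       (flat (j + 2) t - real j * flat (j + 1) t)) (at t)" by simp
    then show ?thesis
      by (subst DERIV_cong_ev[OF refl ev refl]) (simp add: divide_inverse power_inverse)
  next
    case 2
    have ev: "eventually (\<lambda>x. flat j x = 0) (nhds t)"
      using eventually_nhds_in_open[of "{..<0}" t] 2
      by (auto elim!: eventually_mono simp: flat_def)
    show ?thesis
      by (subst DERIV_cong_ev[OF refl ev refl]) (use 2 in \<open>simp add: flat_def\<close>)
  next
    case 3
    have "(\<lambda>h. flat j h / h) \<midarrow>0\<rightarrow> 0"
    proof (rule Lim_null_comparison)
      show "\<forall>\<^sub>F h in at 0. norm (flat j h / h) \<le> fact (j + 2) * \<bar>h\<bar>"
      proof (rule always_eventually, rule allI)
        fix h :: real
        show "norm (flat j h / h) \<le> fact (j + 2) * \<bar>h\<bar>"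
          using flat_le_square[of j h]
          by (cases "h = 0") (simp_all add: abs_divide divide_le_eq power2_eq_square mult.assoc)
      qed
      show "((\<lambda>h::real. fact (j + 2) * \<bar>h\<bar>) \<longlongrightarrow> 0) (at 0)"
        by (rule tendsto_eq_intros refl | simp)+
    qed
    then show ?thesis using 3 by (simp add: DERIV_def flat_def)
  qed
qed

lemma partial_deriv_eq:
  "(f has_derivative D) (at x) \<Longrightarrow> partial_deriv i f x = D (axis i 1)"
  by (simp add: partial_deriv_def frechet_derivative_at[symmetric])

lemma C_k_continuous: "C_k k f \<Longrightarrow> continuous_on UNIV f"
  by (cases k) (auto simp: continuous_on_eq_continuous_at intro: differentiable_imp_continuous_within)

lemma C_k_SucD: "C_k (Suc k) f \<Longrightarrow> C_k k f"
proof (induction k arbitrary: f)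
  case 0
  then show ?case using C_k_continuous[of "Suc 0" f] by simp
next
  case (Suc k)
  then show ?case by (metis C_k.simps(2))
qed

lemma C_k_const: "C_k k (\<lambda>x. c)"
proof (induction k arbitrary: c)
  case (Suc k)
  have "partial_deriv i (\<lambda>x::real^'a. c) = (\<lambda>x. 0)" for i
    by (rule ext) (rule partial_deriv_eq, rule has_derivative_const)
  then show ?case using Suc by simp
qed simp

lemma C_k_add: "C_k k f \<Longrightarrow> C_k k g \<Longrightarrow> C_k k (\<lambda>x. f x + g x)"
proof (induction k arbitrary: f g)
  case (Suc k)
  have "partial_deriv i (\<lambda>x. f x + g x) = (\<lambda>x. partial_deriv i f x + partial_deriv i g x)" for i
  proof
    fix x
    have "(f has_derivative frechet_derivative f (at x)) (at x)"
      "(g has_derivative frechet_derivative g (at x)) (at x)"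
      using Suc.prems by (auto simp: frechet_derivative_works)
    from partial_deriv_eq[OF has_derivative_add[OF this], of i]
    show "partial_deriv i (\<lambda>x. f x + g x) x = partial_deriv i f x + partial_deriv i g x"
      by (simp add: partial_deriv_def)
  qed
  then show ?case using Suc by auto
qed (auto intro: continuous_intros)

lemma C_k_mult: "C_k k f \<Longrightarrow> C_k k g \<Longrightarrow> C_k k (\<lambda>x. f x * g x)"
proof (induction k arbitrary: f g)
  case (Suc k)
  have pd: "partial_deriv i (\<lambda>x. f x * g x)
      = (\<lambda>x. f x * partial_deriv i g x + partial_deriv i f x * g x)" for i
  proof
    fix x
    have "(f has_derivative frechet_derivative f (at x)) (at x)"
      "(g has_derivative frechet_derivative g (at x)) (at x)"
      using Suc.prems by (auto simp: frechet_derivative_works)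
    from partial_deriv_eq[OF has_derivative_mult[OF this], of i]
    show "partial_deriv i (\<lambda>x. f x * g x) x = f x * partial_deriv i g x + partial_deriv i f x * g x"
      by (simp add: partial_deriv_def)
  qed
  have "C_k k (partial_deriv i (\<lambda>x. f x * g x))" for i
    unfolding pd using Suc.prems by (intro C_k_add Suc.IH) (auto intro: C_k_SucD)
  then show ?case using Suc.prems by auto
qed (auto intro: continuous_intros)

lemma C_k_coordinate: "C_k k (\<lambda>x. x $ i)"
proof (cases k)
  case (Suc m)
  have d: "((\<lambda>x. x $ i) has_derivative (\<lambda>h. h $ i)) (at x)" for x :: "real^'a"
    by (intro bounded_linear_imp_has_derivative bounded_linear_vec_nth)
  then have "partial_deriv j (\<lambda>x::real^'a. x $ i) = (\<lambda>x. axis j 1 $ i)" for j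
    by (intro ext partial_deriv_eq)
  then show ?thesis using Suc d by (auto simp: C_k_const differentiable_def)
qed (auto intro: continuous_intros)

text \<open>
  A partial derivative of \<open>flat j \<circ> u\<close> is a combination of \<open>flat (j + 1) \<circ> u\<close> and
  \<open>flat (j + 2) \<circ> u\<close> times a partial derivative of \<open>u\<close>, so induction on \<open>k\<close> works with \<open>j\<close>
  arbitrary.
\<close>

lemma C_k_flat_comp:
  assumes "\<And>k. C_k k u"
  shows "C_k k (\<lambda>x. flat j (u x))"
proof (induction k arbitrary: j)
  case 0
  have "isCont (flat j) t" for t using DERIV_flat DERIV_isCont by blast
  then have "continuous_on UNIV (flat j)" by (simp add: continuous_at_imp_continuous_on)
  moreover have "continuous_on UNIV u" using assms[of 0] by simp
  ultimately show ?case by (simp add: continuous_on_compose2)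
next
  case (Suc k)
  have d: "((\<lambda>x. flat j (u x)) has_derivative
     (\<lambda>h. (flat (j + 2) (u x) - real j * flat (j + 1) (u x)) * frechet_derivative u (at x) h)) (at x)" for x
  proof -
    have "(u has_derivative frechet_derivative u (at x)) (at x)"
      using assms[of "Suc 0"] by (auto simp: frechet_derivative_works)
    from has_derivative_compose[OF this DERIV_flat[unfolded has_field_derivative_def]]
    show ?thesis by simp
  qed
  have pd: "partial_deriv i (\<lambda>x. flat j (u x))
    = (\<lambda>x. (flat (j + 2) (u x) + (- real j) * flat (j + 1) (u x)) * partial_deriv i u x)" for i
    by (rule ext) (simp add: partial_deriv_eq[OF d] partial_deriv_def)
  have "C_k k (partial_deriv i u)" for i using assms[of "Suc k"] by simp
  then have "C_k k (partial_deriv i (\<lambda>x. flat j (u x)))" for i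
    unfolding pd by (intro C_k_mult C_k_add C_k_const Suc)
  then show ?case using d by (auto simp: differentiable_def)
qed

text \<open>
  The argument of \<open>flat\<close> is at least 3 on \<open>B(c,R)\<close> and nonpositive outside \<open>B(c,2R)\<close>. The bump
  is not constant on the inner ball; a lower bound there is enough for testing the inequality.
\<close>

definition bump :: "real ^ 'n::finite \<Rightarrow> real \<Rightarrow> real ^ 'n \<Rightarrow> real" where
  "bump c R x = flat 0 (4 - (dist x c)\<^sup>2 / R\<^sup>2)"

lemma has_derivative_parabola:
  fixes c :: "real^'n::finite"
  shows "((\<lambda>x. 4 - (dist x c)\<^sup>2 / R\<^sup>2) has_derivative (\<lambda>h. (- 2 / R\<^sup>2) * ((x - c) \<bullet> h))) (at x)"
  unfolding dist_norm power2_norm_eq_inner divide_inverse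
  by (rule derivative_eq_intros refl | simp add: inner_commute algebra_simps)+

lemma partial_deriv_parabola:
  fixes c :: "real^'n::finite"
  shows "partial_deriv i (\<lambda>x. 4 - (dist x c)\<^sup>2 / R\<^sup>2) = (\<lambda>x. (- 2 / R\<^sup>2) * (x $ i + - c $ i))"
  by (rule ext) (simp add: partial_deriv_eq[OF has_derivative_parabola] inner_axis)

lemma C_k_parabola: "C_k k (\<lambda>x. 4 - (dist x c)\<^sup>2 / R\<^sup>2)"
proof (cases k)
  case 0 then show ?thesis by (auto simp: divide_inverse intro!: continuous_intros)
next
  case (Suc m)
  have "C_k m (\<lambda>x. (- 2 / R\<^sup>2) * (x $ i + - c $ i))" for i
    by (intro C_k_mult C_k_add C_k_const C_k_coordinate)
  then show ?thesis unfolding Suc C_k.simps partial_deriv_parabola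
    using has_derivative_parabola unfolding differentiable_def by blast
qed

lemma flat_parabola_eq_0: "R > 0 \<Longrightarrow> x \<notin> ball c (2 * R) \<Longrightarrow> flat j (4 - (dist x c)\<^sup>2 / R\<^sup>2) = 0"
proof -
  assume "R > 0" "x \<notin> ball c (2 * R)"
  then have "(2 * R)\<^sup>2 \<le> (dist x c)\<^sup>2" by (intro power_mono) (auto simp: dist_commute)
  then show ?thesis using \<open>R > 0\<close> by (simp add: flat_def field_simps power2_eq_square)
qed

lemma bump_in_C0_infinity:
  assumes "R > 0" shows "bump c R \<in> C0_infinity"
proof -
  have "{x. bump c R x \<noteq> 0} \<subseteq> ball c (2 * R)"
    using flat_parabola_eq_0[OF assms, of _ c 0] unfolding bump_def by blast
  then have "bounded {x. bump c R x \<noteq> 0}" using bounded_ball bounded_subset by blast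
  moreover have "C_k k (bump c R)" for k
    unfolding bump_def[abs_def] by (rule C_k_flat_comp) (rule C_k_parabola)
  ultimately show ?thesis by (auto simp: C0_infinity_def compact_closure)
qed

lemma bump_lower_bound:
  assumes "R > 0" "x \<in> ball c R" shows "exp (- 1 / 3) \<le> bump c R x"
proof -
  define t where "t = 4 - (dist x c)\<^sup>2 / R\<^sup>2"
  have "(dist x c)\<^sup>2 \<le> R\<^sup>2" using assms by (intro power_mono) (auto simp: dist_commute)
  then have "t \<ge> 3" using assms by (simp add: t_def divide_le_eq)
  then have "1 / t \<le> 1 / 3" by (simp add: frac_le)
  then show ?thesis using \<open>t \<ge> 3\<close> by (simp add: bump_def flat_def t_def[symmetric])
qed

lemma norm_gradient_bump:
  assumes "R > 0" shows "norm (gradient (bump c R) x) \<le> 8 / R * indicator (ball c (2 * R)) x"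
proof -
  let ?u = "\<lambda>x. 4 - (dist x c)\<^sup>2 / R\<^sup>2"
  have "(bump c R has_derivative (\<lambda>h. (- 2 / R\<^sup>2) * ((x - c) \<bullet> h) * flat 2 (?u x))) (at x)"
    using has_derivative_compose[OF has_derivative_parabola
        DERIV_flat[of 0, unfolded has_field_derivative_def], of c R x]
    by (simp add: bump_def[abs_def] mult.commute mult.assoc numeral_2_eq_2)
  then have "gradient (bump c R) x = (flat 2 (?u x) * (- 2 / R\<^sup>2)) *\<^sub>R (x - c)"
    by (simp add: gradient_def vec_eq_iff partial_deriv_eq inner_axis)
  then have eq: "norm (gradient (bump c R) x) = flat 2 (?u x) * (2 / R\<^sup>2) * dist x c"
    by (simp add: abs_mult flat_nonneg dist_norm)
  show ?thesis
  proof (cases "x \<in> ball c (2 * R)")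
    case True
    have "flat 2 (?u x) * (2 / R\<^sup>2) * dist x c \<le> 2 * (2 / R\<^sup>2) * (2 * R)"
      using True assms flat_le_fact[of 2 "?u x"]
      by (intro mult_mono mult_right_mono) (auto simp: dist_commute flat_nonneg fact_2)
    also have "\<dots> = 8 / R" using assms by (simp add: field_simps power2_eq_square)
    finally show ?thesis using True eq by simp
  next
    case False
    then show ?thesis using eq flat_parabola_eq_0[OF assms False, of 2] by simp
  qed
qed

section \<open>Testing the Hardy--Sobolev inequality\<close>

lemma bump_gradient_integral_le:
  fixes E :: "(real ^ 'n::finite) set"
  assumes "x \<in> E" "0 < R" "0 \<le> \<beta>" "0 < p"
  shows "(\<integral>\<^sup>+y. ennreal (norm (gradient (bump x R) y) powr p) * dist_powr E \<beta> y \<partial>lborel)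
    \<le> ennreal (8 powr p * 2 powr (\<beta> + real CARD('n)) * unit_ball_vol (real CARD('n))
        * R powr (real CARD('n) - p + \<beta>))"
proof -
  have le: "ennreal (norm (gradient (bump x R) y) powr p) * dist_powr E \<beta> y
      \<le> ennreal ((8 / R) powr p * (2 * R) powr \<beta>) * indicator (ball x (2 * R)) y" for y
  proof (cases "y \<in> ball x (2 * R)")
    case True
    have "infdist y E \<le> 2 * R"
      using infdist_le[OF \<open>x \<in> E\<close>, of y] True by (simp add: dist_commute)
    then have "dist_powr E \<beta> y \<le> ennreal ((2 * R) powr \<beta>)"
      using assms by (intro dist_powr_le) auto
    moreover have "norm (gradient (bump x R) y) powr p \<le> (8 / R) powr p"
      using norm_gradient_bump[OF \<open>0 < R\<close>, of x y] True assms by (intro powr_mono2) auto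
    ultimately show ?thesis
      using True by (simp add: ennreal_mult mult_mono ennreal_leI)
  next
    case False
    then show ?thesis using norm_gradient_bump[OF \<open>0 < R\<close>, of x y] assms by simp
  qed
  have "(\<integral>\<^sup>+y. ennreal (norm (gradient (bump x R) y) powr p) * dist_powr E \<beta> y \<partial>lborel)
     \<le> (\<integral>\<^sup>+y. ennreal ((8 / R) powr p * (2 * R) powr \<beta>) * indicator (ball x (2 * R)) y \<partial>lborel)"
    by (intro nn_integral_mono le)
  also have "\<dots> = ennreal ((8 / R) powr p * (2 * R) powr \<beta>) * emeasure lborel (ball x (2 * R))"
    by (simp add: nn_integral_cmult_indicator)
  also have "emeasure lborel (ball x (2 * R)) = ennreal (unit_ball_vol (real CARD('n)) * (2 * R) powr real CARD('n))"
    using \<open>0 < R\<close> by (simp add: emeasure_ball powr_realpow)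
  also have "ennreal ((8 / R) powr p * (2 * R) powr \<beta>) * \<dots>
     = ennreal (8 powr p * 2 powr (\<beta> + real CARD('n)) * unit_ball_vol (real CARD('n))
        * R powr (real CARD('n) - p + \<beta>))"
    using \<open>0 < R\<close>
    by (simp add: powr_mult powr_divide powr_add powr_diff mult_ac flip: ennreal_mult)
  finally show ?thesis .
qed

lemma bump_integral_ge:
  assumes "0 < R" "0 < q"
  shows "ennreal (exp (- q / 3)) * (\<integral>\<^sup>+y\<in>ball x R. dist_powr E s y \<partial>lborel)
    \<le> (\<integral>\<^sup>+y. ennreal (\<bar>bump x R y\<bar> powr q) * dist_powr E s y \<partial>lborel)"
proof -
  have le: "ennreal (exp (- q / 3)) * (dist_powr E s y * indicator (ball x R) y)
     \<le> ennreal (\<bar>bump x R y\<bar> powr q) * dist_powr E s y" for y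
  proof (cases "y \<in> ball x R")
    case True
    have "exp (- q / 3) = exp (- 1 / 3) powr q" by (simp add: powr_def)
    also have "\<dots> \<le> \<bar>bump x R y\<bar> powr q"
      using bump_lower_bound[OF \<open>0 < R\<close> True] assms by (intro powr_mono2) auto
    finally show ?thesis using True by (simp add: mult_right_mono ennreal_leI)
  qed simp
  have "ennreal (exp (- q / 3)) * (\<integral>\<^sup>+y\<in>ball x R. dist_powr E s y \<partial>lborel)
     = (\<integral>\<^sup>+y. ennreal (exp (- q / 3)) * (dist_powr E s y * indicator (ball x R) y) \<partial>lborel)"
    by (intro nn_integral_cmult[symmetric] borel_measurable_times_ennreal borel_measurable_indicator)
      (simp_all add: dist_powr_measurable)
  also have "\<dots> \<le> (\<integral>\<^sup>+y. ennreal (\<bar>bump x R y\<bar> powr q) * dist_powr E s y \<partial>lborel)"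
    by (intro nn_integral_mono le)
  finally show ?thesis .
qed

text \<open>
  The right-hand side of the inequality for the bump on \<open>B(x,2R)\<close> is at most a constant times
  \<open>R\<close> to the power \<open>(n - p + \<beta>) / p = s / q\<close>; raising to the power \<open>q\<close> gives \<open>R\<^sup>s\<close>.
\<close>

lemma aikawa_if_hardy_sobolev:
  fixes E :: "(real ^ 'n::finite) set" and p q \<beta> C :: real
  defines "s \<equiv> (q / p) * (real CARD('n) - p + \<beta>)"
  assumes "0 < p" "0 < q" "0 \<le> \<beta>" "0 < C"
    and hs: "\<And>f. f \<in> C0_infinity \<Longrightarrow>
      ennpowr (\<integral>\<^sup>+ x. ennreal (\<bar>f x\<bar> powr q) * dist_powr E (s - real CARD('n)) x \<partial>lborel) (1 / q)
      \<le> ennreal C *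
        ennpowr (\<integral>\<^sup>+ x. ennreal (norm (gradient f x) powr p) * dist_powr E \<beta> x \<partial>lborel) (1 / p)"
  shows "\<exists>C'\<ge>0. \<forall>x\<in>E. \<forall>R>0.
    (\<integral>\<^sup>+y\<in>ball x R. dist_powr E (s - real CARD('n)) y \<partial>lborel) \<le> ennreal (C' * R powr s)"
proof -
  define M where "M = 8 powr p * 2 powr (\<beta> + real CARD('n)) * unit_ball_vol (real CARD('n))"
  define e where "e = real CARD('n) - p + \<beta>"
  have "0 < M" by (simp add: M_def)
  have "(\<integral>\<^sup>+y\<in>ball x R. dist_powr E (s - real CARD('n)) y \<partial>lborel)
      \<le> ennreal (exp (q / 3) * (C powr q * M powr (q / p)) * R powr s)" if "x \<in> E" "0 < R" for x R
  proof -
    let ?L = "\<integral>\<^sup>+ y. ennreal (\<bar>bump x R y\<bar> powr q) * dist_powr E (s - real CARD('n)) y \<partial>lborel"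
    let ?G = "\<integral>\<^sup>+y. ennreal (norm (gradient (bump x R) y) powr p) * dist_powr E \<beta> y \<partial>lborel"
    let ?I = "\<integral>\<^sup>+y\<in>ball x R. dist_powr E (s - real CARD('n)) y \<partial>lborel"
    have "?G \<le> ennreal (M * R powr e)"
      unfolding M_def e_def using that assms by (intro bump_gradient_integral_le) auto
    then have G: "ennpowr ?G (1 / p) \<le> ennreal ((M * R powr e) powr (1 / p))"
      using \<open>0 < M\<close> \<open>0 < p\<close> by (intro ennpowr_le_I) auto
    have "ennpowr ?L (1 / q) \<le> ennreal C * ennpowr ?G (1 / p)"
      using that by (intro hs bump_in_C0_infinity)
    also have "\<dots> \<le> ennreal (C * (M * R powr e) powr (1 / p))"
      using G \<open>0 < C\<close> by (simp add: ennreal_mult mult_left_mono)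
    finally have "?L \<le> ennreal ((C * (M * R powr e) powr (1 / p)) powr (1 / (1 / q)))"
      using \<open>0 < q\<close> by (intro ennpowr_le_D) auto
    also have "(C * (M * R powr e) powr (1 / p)) powr (1 / (1 / q)) = C powr q * M powr (q / p) * R powr s"
      using \<open>0 < C\<close> \<open>0 < M\<close> \<open>0 < R\<close> by (simp add: powr_mult powr_powr s_def e_def mult.commute)
    finally have L: "?L \<le> ennreal (C powr q * M powr (q / p) * R powr s)" .
    have "?I = ennreal (exp (q / 3)) * (ennreal (exp (- q / 3)) * ?I)"
      by (simp add: mult.assoc[symmetric] flip: ennreal_mult exp_add)
    also have "\<dots> \<le> ennreal (exp (q / 3)) * ?L"
      using that \<open>0 < q\<close> by (intro mult_left_mono bump_integral_ge) auto
    also have "\<dots> \<le> ennreal (exp (q / 3)) * ennreal (C powr q * M powr (q / p) * R powr s)"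
      using L by (intro mult_left_mono) auto
    also have "\<dots> = ennreal (exp (q / 3) * (C powr q * M powr (q / p)) * R powr s)"
      by (simp add: mult.assoc flip: ennreal_mult)
    finally show ?thesis .
  qed
  then show ?thesis
    by (intro exI[of _ "exp (q / 3) * (C powr q * M powr (q / p))"]) auto
qed

theorem theorem6p1:
  fixes E :: "(real ^ 'n::finite) set" and p q \<beta> :: real
  assumes "CARD('n) \<ge> 2"
    and "E \<noteq> {}" and "closed E"
    and "1 \<le> p" and "1 \<le> q" and "\<beta> \<ge> 0"
    and "q * (real CARD('n) - p + \<beta>) / p \<noteq> real CARD('n)"
    and "\<exists>C::real>0. \<forall>f\<in>C0_infinity.
      ennpowr (\<integral>\<^sup>+ x. ennreal (\<bar>f x\<bar> powr q) *
          dist_powr E ((q / p) * (real CARD('n) - p + \<beta>) - real CARD('n)) x \<partial>lborel) (1 / q)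
      \<le> ennreal C *
        ennpowr (\<integral>\<^sup>+ x. ennreal (norm (gradient f x) powr p) * dist_powr E \<beta> x \<partial>lborel) (1 / p)"
  shows "upper_assouad_dim E < ereal ((q / p) * (real CARD('n) - p + \<beta>))"
proof -
  define s where "s = (q / p) * (real CARD('n) - p + \<beta>)"
  have "s \<noteq> real CARD('n)" using assms(7) by (simp add: s_def)
  then consider "real CARD('n) < s" | "s < real CARD('n)" by linarith
  then have "upper_assouad_dim E < ereal s"
  proof cases
    case 1
    have "upper_assouad_dim E \<le> ereal (real CARD('n))"
      using upper_assouad_dim_le_DIM[of E] by simp
    also have "\<dots> < ereal s" using 1 by simp
    finally show ?thesis .
  next
    case 2
    obtain C where "0 < C" and "\<forall>f\<in>C0_infinity.
      ennpowr (\<integral>\<^sup>+ x. ennreal (\<bar>f x\<bar> powr q) * dist_powr E (s - real CARD('n)) x \<partial>lborel) (1 / q)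
      \<le> ennreal C *
        ennpowr (\<integral>\<^sup>+ x. ennreal (norm (gradient f x) powr p) * dist_powr E \<beta> x \<partial>lborel) (1 / p)"
      using assms(8) unfolding s_def by blast
    then obtain C' where C': "0 \<le> C'" "\<forall>x\<in>E. \<forall>R>0.
      (\<integral>\<^sup>+y\<in>ball x R. dist_powr E (s - real CARD('n)) y \<partial>lborel) \<le> ennreal (C' * R powr s)"
      using aikawa_if_hardy_sobolev[of p q \<beta> C E] assms(4-6) unfolding s_def by auto
    show ?thesis
      using upper_assouad_dim_less_if_aikawa[of E s C'] assms(2) 2 C' by simp
  qed
  then show ?thesis by (simp add: s_def)
qed

end
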